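(* Let $G=(C,I,E)$ be a connected block-split graph that is not a tree and is not isomorphic to $K_3$. Then $G$ admits a HIST if and only if $G$ contains at least two good vertices.
   Context: All graphs are finite, simple and undirected. A HIST (homeomorphically irreducible spanning tree) of a connected graph $G$ is a spanning tree of $G$ with no vertex of degree exactly $2$ in the tree. A split graph $G=(C,I,E)$ is a graph whose vertex set is partitioned into $C$ and $I$, where $C$ induces a clique and $I$ induces an independent set. A block-split graph is a split graph $G=(C,I,E)$ in which every vertex of $I$ has degree at most one (so, when $G$ is connected, every vertex of $I$ is a pendant vertex adjacent to exactly one vertex of $C$). A vertex $u\in C$ is called good if its degree $d(u)$ in $G$ satisfies $d(u)\neq |C|$, and bad otherwise (equivalently, a good vertex of $C$ has either $0$ or at least $2$ neighbours in $I$, and a bad vertex has exactly one neighbour in $I$). *)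

theory Defs
  imports Main
begin

text \<open>
  A finite simple undirected graph is a vertex set together with a set of two-element vertex sets.
\<close>

locale simple_graph =
  fixes V :: "'a set" and E :: "'a set set"
  assumes finite_vertices: "finite V"
    and edges: "e \<in> E \<Longrightarrow> e \<subseteq> V \<and> card e = 2"

definition degree :: "'a set set \<Rightarrow> 'a \<Rightarrow> nat" where
  "degree E v = card {e \<in> E. v \<in> e}"

text \<open>The null graph is not connected.\<close>

definition connected_graph :: "'a set \<Rightarrow> 'a set set \<Rightarrow> bool" where
  "connected_graph V E \<longleftrightarrow>
     V \<noteq> {} \<and> (\<forall>u\<in>V. \<forall>v\<in>V. (u, v) \<in> {(x, y). {x, y} \<in> E}\<^sup>*)"

text \<open>
  A cycle is given by the list of its distinct vertices in cyclic order; the length bound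
  excludes running back and forth along a single edge.
\<close>

definition cycle_of :: "'a set set \<Rightarrow> 'a list \<Rightarrow> bool" where
  "cycle_of E p \<longleftrightarrow>
     3 \<le> length p \<and> distinct p \<and>
     (\<forall>i < length p. {p ! i, p ! (Suc i mod length p)} \<in> E)"

definition tree :: "'a set \<Rightarrow> 'a set set \<Rightarrow> bool" where
  "tree V E \<longleftrightarrow> simple_graph V E \<and> connected_graph V E \<and> \<not> (\<exists>p. cycle_of E p)"

definition spanning_tree :: "'a set \<Rightarrow> 'a set set \<Rightarrow> 'a set set \<Rightarrow> bool" where
  "spanning_tree V E T \<longleftrightarrow> T \<subseteq> E \<and> tree V T"

definition HIST :: "'a set \<Rightarrow> 'a set set \<Rightarrow> 'a set set \<Rightarrow> bool" where
  "HIST V E T \<longleftrightarrow> spanning_tree V E T \<and> (\<forall>v\<in>V. degree T v \<noteq> 2)"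

definition isomorphic :: "'a set \<Rightarrow> 'a set set \<Rightarrow> 'b set \<Rightarrow> 'b set set \<Rightarrow> bool" where
  "isomorphic V E V' E' \<longleftrightarrow>
     (\<exists>f. bij_betw f V V' \<and> (\<forall>u\<in>V. \<forall>v\<in>V. {u, v} \<in> E \<longleftrightarrow> {f u, f v} \<in> E'))"

definition complete_edges :: "'a set \<Rightarrow> 'a set set" where
  "complete_edges V = {e. e \<subseteq> V \<and> card e = 2}"

locale split_graph = simple_graph V E
  for V :: "'a set" and E :: "'a set set" +
  fixes C I :: "'a set"
  assumes partition: "C \<union> I = V" "C \<inter> I = {}"
    and clique: "\<lbrakk>u \<in> C; v \<in> C; u \<noteq> v\<rbrakk> \<Longrightarrow> {u, v} \<in> E"
    and independent: "\<lbrakk>u \<in> I; v \<in> I\<rbrakk> \<Longrightarrow> {u, v} \<notin> E"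

locale block_split_graph = split_graph +
  assumes degree_independent: "v \<in> I \<Longrightarrow> degree E v \<le> 1"

definition good :: "'a set set \<Rightarrow> 'a set \<Rightarrow> 'a \<Rightarrow> bool" where
  "good E C u \<longleftrightarrow> u \<in> C \<and> degree E u \<noteq> card C"

end

theory Submission
  imports Defs
begin

text \<open>
  Every spanning tree contains all pendant edges, so a HIST amounts to a spanning tree of the
  clique in which the degree of \<open>v\<close> plus its number of pendant neighbours is never 2. As a bad
  vertex has exactly one pendant neighbour, it cannot be a leaf of the clique tree: the two ends of
  a longest path in the clique tree are good. Conversely, a clique tree all of whose leaves
  are good and whose inner vertices are all bad serves; if there is no bad vertex, a star does,
  centred at a vertex of degree other than 2, which exists unless the graph is \<open>K\<^sub>3\<close>.
\<close>

section \<open>Cycles, and trees given by parent functions\<close>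

lemma cycle_of_two_neighbours:
  assumes "cycle_of E p" "x \<in> set p"
  obtains y z where "y \<noteq> z" "{x, y} \<in> E" "{x, z} \<in> E" "y \<in> set p" "z \<in> set p"
proof -
  let ?n = "length p"
  have n: "3 \<le> ?n" and d: "distinct p"
    and e: "\<And>i. i < ?n \<Longrightarrow> {p ! i, p ! (Suc i mod ?n)} \<in> E"
    using assms(1) by (auto simp: cycle_of_def)
  obtain i where i: "i < ?n" "x = p ! i"
    using assms(2) by (metis in_set_conv_nth)
  \<comment> \<open>\<open>j\<close> and \<open>k\<close> are the cyclic predecessor and successor
    of \<open>i\<close>; they differ because the length is at least 3.\<close>
  define j where "j = (if i = 0 then ?n - 1 else i - 1)"
  define k where "k = Suc i mod ?n"
  have j: "j < ?n" "Suc j mod ?n = i"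
    using i n by (auto simp: j_def)
  have k: "k < ?n" "j \<noteq> k"
    using i n by (auto simp: j_def k_def mod_Suc)
  show thesis
  proof
    show "p ! j \<noteq> p ! k"
      using d j k by (simp add: nth_eq_iff_index_eq)
    show "{x, p ! j} \<in> E"
      using e[OF j(1)] j(2) i by (simp add: insert_commute)
    show "{x, p ! k} \<in> E"
      using e[OF i(1)] i(2) by (simp add: k_def)
  qed (use j k in auto)
qed

text \<open>All trees below are built this way: the strict drop of \<open>rk\<close> along
  \<open>par\<close> rules out loops, makes iterated parents end at \<open>r\<close> and forbids
  cycles, so one inequality per vertex suffices.\<close>

lemma tree_of_parent:
  fixes rk :: "'a \<Rightarrow> nat"
  assumes fin: "finite V" and r: "r \<in> V"
    and par: "\<And>v. v \<in> V \<Longrightarrow> v \<noteq> r \<Longrightarrow> par v \<in> V \<and> rk (par v) < rk v"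
  shows "tree V ((\<lambda>v. {v, par v}) ` (V - {r}))"
proof -
  let ?T = "(\<lambda>v. {v, par v}) ` (V - {r})"
  let ?R = "{(x, y). {x, y} \<in> ?T}"
  have "simple_graph V ?T"
  proof
    fix e assume "e \<in> ?T"
    then obtain v where v: "v \<in> V" "v \<noteq> r" "e = {v, par v}" by auto
    then have "par v \<in> V" "rk (par v) < rk v" using par by blast+
    then have "v \<noteq> par v" by (metis less_irrefl)
    then show "e \<subseteq> V \<and> card e = 2"
      using v \<open>par v \<in> V\<close> by simp
  qed (fact fin)
  moreover have "connected_graph V ?T"
  proof -
    have root: "(v, r) \<in> ?R\<^sup>*" if "v \<in> V" for v
      using that
    proof (induction "rk v" arbitrary: v rule: less_induct)
      case less
      show ?case
      proof (cases "v = r")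
        case False
        then have "(par v, r) \<in> ?R\<^sup>*" using less par by blast
        moreover have "(v, par v) \<in> ?R" using False less.prems by auto
        ultimately show ?thesis by (meson converse_rtrancl_into_rtrancl)
      qed simp
    qed
    have "sym ?R" by (auto simp: sym_def insert_commute)
    then have "sym (?R\<^sup>*)" by (rule sym_rtrancl)
    with root have "(u, v) \<in> ?R\<^sup>*" if "u \<in> V" "v \<in> V" for u v
      using that by (meson rtrancl_trans symD)
    with r show ?thesis unfolding connected_graph_def by blast
  qed
  moreover have "\<not> cycle_of ?T p" for p
  proof
    assume c: "cycle_of ?T p"
    then have "p \<noteq> []" by (auto simp: cycle_of_def)
    then have "Max (rk ` set p) \<in> rk ` set p" by simp
    then obtain x where x: "x \<in> set p" "rk x = Max (rk ` set p)" by auto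
    then have mx: "rk y \<le> rk x" if "y \<in> set p" for y using that by simp
    \<comment> \<open>at a vertex of maximal rank, both cycle edges lead to its parent\<close>
    have up: "y = par x" if xy: "{x, y} \<in> ?T" and y: "y \<in> set p" for y
    proof -
      obtain v where v: "v \<in> V" "v \<noteq> r" "{x, y} = {v, par v}" using xy by auto
      then have "rk (par v) < rk v" using par by blast
      with v(3) mx[OF y] show ?thesis by (metis doubleton_eq_iff leD)
    qed
    show False
      using cycle_of_two_neighbours[OF c x(1)] up by metis
  qed
  ultimately show ?thesis by (simp add: tree_def)
qed

section \<open>Pendant edges, degrees and cycles in a block-split graph\<close>

context block_split_graph
begin

text \<open>Encoded as a complement, so it is disjoint from every set of edges inside
  \<open>C\<close> and degrees add up over such a union. By independence each member has exactly one
  end in \<open>I\<close>.\<close>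

definition pendant_edges :: "'a set set" where
  "pendant_edges = {e \<in> E. \<not> e \<subseteq> C}"

lemma finite_C: "finite C"
  using partition finite_vertices by auto

lemma finite_E: "finite E"
  by (rule finite_subset[of _ "Pow V"]) (use edges finite_vertices in auto)

lemma pendant_unique:
  assumes "x \<in> I" "{x, y} \<in> E" "{x, z} \<in> E"
  shows "y = z"
proof -
  have "card {e \<in> E. x \<in> e} \<le> 1"
    using degree_independent[OF assms(1)] by (simp add: degree_def)
  then have "{x, y} = {x, z}"
    using assms finite_E by (subst (asm) card_le_Suc0_iff_eq[unfolded One_nat_def[symmetric]]) auto
  then show ?thesis by (auto simp: doubleton_eq_iff)
qed

lemma pendant_edge_cases:
  assumes "e \<in> pendant_edges"
  obtains x w where "x \<in> I" "w \<in> C" "e = {x, w}"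
proof -
  have e: "e \<in> E" "\<not> e \<subseteq> C" using assms by (auto simp: pendant_edges_def)
  then obtain x where x: "x \<in> e" "x \<notin> C" by auto
  have "e \<subseteq> V" "card e = 2" using edges e(1) by auto
  then obtain w where w: "e = {x, w}" using x(1) by (auto simp: card_2_iff)
  have "x \<in> I" "w \<in> C"
    using x w \<open>e \<subseteq> V\<close> partition independent e(1) by auto
  from that[OF this w] show thesis .
qed

lemma degree_clique:
  assumes "v \<in> C"
  shows "degree E v = card C - 1 + degree pendant_edges v"
proof -
  have "{e \<in> E. v \<in> e} = (\<lambda>u. {u, v}) ` (C - {v}) \<union> {e \<in> pendant_edges. v \<in> e}"
  proof (intro equalityI subsetI)
    fix e assume "e \<in> {e \<in> E. v \<in> e}"
    moreover from this obtain u where "e = {u, v}" "u \<noteq> v"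
      using edges[of e] by (auto simp: card_2_iff)
    ultimately show "e \<in> (\<lambda>u. {u, v}) ` (C - {v}) \<union> {e \<in> pendant_edges. v \<in> e}"
      using assms by (auto simp: pendant_edges_def)
  qed (use clique assms in \<open>auto simp: pendant_edges_def\<close>)
  moreover have "(\<lambda>u. {u, v}) ` (C - {v}) \<inter> {e \<in> pendant_edges. v \<in> e} = {}"
    using assms by (auto simp: pendant_edges_def)
  moreover have "finite {e \<in> pendant_edges. v \<in> e}"
    using finite_E by (simp add: pendant_edges_def)
  moreover have "card ((\<lambda>u. {u, v}) ` (C - {v})) = card C - 1"
    using assms finite_C by (subst card_image) (auto simp: inj_on_def doubleton_eq_iff)
  ultimately show ?thesis
    using finite_C unfolding degree_def by (simp add: card_Un_disjoint)
qed

text \<open>The other clique vertices account for \<open>card C - 1\<close> edges at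
  \<open>v\<close>, so degree \<open>card C\<close> means exactly one pendant edge. Goodness thus
  becomes a condition on pendant edges alone.\<close>

lemma good_iff: "good E C v \<longleftrightarrow> v \<in> C \<and> degree pendant_edges v \<noteq> 1"
proof -
  \<comment> \<open>Nonemptiness keeps the truncated \<open>card C - 1\<close> one below
    \<open>card C\<close>.\<close>
  have "card C > 0" if "v \<in> C" using that finite_C card_gt_0_iff by blast
  then show ?thesis by (auto simp: good_def degree_clique)
qed

lemma degree_split:
  assumes "S \<subseteq> E" "\<forall>e\<in>S. e \<subseteq> C"
  shows "degree (S \<union> pendant_edges) v = degree S v + degree pendant_edges v"
proof -
  have "finite S" "finite pendant_edges"
    using assms(1) finite_E finite_subset by (auto simp: pendant_edges_def)
  moreover have "{e \<in> S \<union> pendant_edges. v \<in> e} = {e \<in> S. v \<in> e} \<union> {e \<in> pendant_edges. v \<in> e}"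
    by auto
  moreover have "{e \<in> S. v \<in> e} \<inter> {e \<in> pendant_edges. v \<in> e} = {}"
    using assms(2) by (auto simp: pendant_edges_def)
  ultimately show ?thesis
    by (simp add: degree_def card_Un_disjoint)
qed

text \<open>A vertex on a cycle has two different neighbours, while a vertex of \<open>I\<close> has
  at most one.\<close>

lemma cycle_subset_clique:
  assumes "cycle_of E p"
  shows "set p \<subseteq> C"
proof
  fix x assume "x \<in> set p"
  then obtain y z where "y \<noteq> z" "{x, y} \<in> E" "{x, z} \<in> E"
    using cycle_of_two_neighbours[OF assms] by metis
  then have "x \<notin> I" "x \<in> V"
    using pendant_unique edges by blast+
  then show "x \<in> C" using partition by auto
qed

text \<open>A connected graph that is not a tree has a cycle, and its at least three distinct
  vertices all lie in \<open>C\<close>.\<close>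

lemma card_clique_ge_3:
  assumes "connected_graph V E" "\<not> tree V E"
  shows "3 \<le> card C"
proof -
  obtain p where p: "cycle_of E p"
    using assms simple_graph_axioms by (auto simp: tree_def)
  then have "3 \<le> card (set p)"
    by (auto simp: cycle_of_def distinct_card)
  also have "\<dots> \<le> card C"
    using cycle_subset_clique[OF p] finite_C by (rule card_mono[rotated])
  finally show ?thesis .
qed

text \<open>A walk in \<open>T\<close> from \<open>x\<close> to a clique vertex is nontrivial; its
  first edge is the one sought.\<close>

lemma connected_pendant_edge:
  assumes "connected_graph V T" "T \<subseteq> E" "x \<in> I" "C \<noteq> {}"
  obtains w where "{x, w} \<in> T"
proof -
  obtain u where u: "u \<in> C" using assms(4) by auto
  then have "x \<noteq> u" "x \<in> V" "u \<in> V" using assms(3) partition by auto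
  then have "(x, u) \<in> {(x, y). {x, y} \<in> T}\<^sup>*"
    using assms(1) by (simp add: connected_graph_def)
  with \<open>x \<noteq> u\<close> obtain w where "(x, w) \<in> {(x, y). {x, y} \<in> T}"
    by (meson converse_rtranclE)
  then show thesis using that by simp
qed

text \<open>Connectivity forces some edge of \<open>T\<close> at each vertex of \<open>I\<close>,
  and \<open>E\<close> offers only one.\<close>

lemma pendant_edges_subset:
  assumes "connected_graph V T" "T \<subseteq> E"
  shows "pendant_edges \<subseteq> T"
proof
  fix e assume e: "e \<in> pendant_edges"
  then obtain x w where xw: "x \<in> I" "w \<in> C" "e = {x, w}" by (rule pendant_edge_cases)
  obtain w' where w': "{x, w'} \<in> T"
    using connected_pendant_edge[OF assms xw(1)] xw(2) by auto
  have "{x, w} \<in> E" using e xw(3) by (simp add: pendant_edges_def)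
  then have "w' = w" using pendant_unique xw(1) w' assms(2) by blast
  with w' xw show "e \<in> T" by simp
qed

section \<open>Building a HIST from a parent function on the clique\<close>

lemma spanning_tree_of_parent:
  fixes rk :: "'a \<Rightarrow> nat"
  assumes conn: "connected_graph V E" and r: "r \<in> C"
    and par: "\<And>v. v \<in> C \<Longrightarrow> v \<noteq> r \<Longrightarrow> par v \<in> C \<and> rk (par v) < rk v"
  shows "spanning_tree V E ((\<lambda>v. {v, par v}) ` (C - {r}) \<union> pendant_edges)"
proof -
  let ?S = "(\<lambda>v. {v, par v}) ` (C - {r})"
  have "\<exists>w. {x, w} \<in> E" if "x \<in> I" for x
    using connected_pendant_edge[OF conn subset_refl that] r by blast
  then obtain nb where nbE: "\<And>x. x \<in> I \<Longrightarrow> {x, nb x} \<in> E" by metis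
  have nbC: "nb x \<in> C" if "x \<in> I" for x
    using nbE[OF that] independent that edges[OF nbE[OF that]] partition by auto
  \<comment> \<open>Each vertex of \<open>I\<close> hangs from its neighbour and gets a rank one
    higher, so the strict drop along parents persists.\<close>
  define q where "q v = (if v \<in> C then par v else nb v)" for v
  define rq where "rq v = (if v \<in> C then rk v else Suc (rk (nb v)))" for v
  have "tree V ((\<lambda>v. {v, q v}) ` (V - {r}))"
  proof (rule tree_of_parent[where rk = rq])
    show "q v \<in> V \<and> rq (q v) < rq v" if "v \<in> V" "v \<noteq> r" for v
      using that par[of v] nbC[of v] partition by (auto simp: q_def rq_def)
  qed (use finite_vertices r partition in auto)
  moreover have "(\<lambda>v. {v, q v}) ` (V - {r}) = ?S \<union> (\<lambda>v. {v, nb v}) ` I"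
  proof -
    have "V - {r} = (C - {r}) \<union> I" using partition r by auto
    moreover have "(\<lambda>v. {v, q v}) ` I = (\<lambda>v. {v, nb v}) ` I"
      by (rule image_cong) (use partition in \<open>auto simp: q_def\<close>)
    ultimately show ?thesis by (simp add: image_Un q_def)
  qed
  moreover have "(\<lambda>v. {v, nb v}) ` I = pendant_edges"
  proof (intro equalityI subsetI)
    fix e assume "e \<in> pendant_edges"
    moreover from this obtain x w where "x \<in> I" "e = {x, w}" by (rule pendant_edge_cases)
    ultimately show "e \<in> (\<lambda>v. {v, nb v}) ` I"
      using pendant_unique nbE by (auto simp: pendant_edges_def)
  qed (use nbE partition in \<open>auto simp: pendant_edges_def\<close>)
  moreover have "?S \<union> pendant_edges \<subseteq> E"
  proof -
    have "{v, par v} \<in> E" if "v \<in> C - {r}" for v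
    proof -
      have "v \<in> C" "par v \<in> C" "rk (par v) < rk v" using that par by blast+
      then show ?thesis by (metis clique less_irrefl)
    qed
    then show ?thesis by (auto simp: pendant_edges_def)
  qed
  ultimately show ?thesis by (simp add: spanning_tree_def)
qed

text \<open>Degrees need checking only on \<open>C\<close>: a vertex of \<open>I\<close> has degree
  at most one already in \<open>E\<close>. On \<open>C\<close> the tree degree is the clique part
  plus the pendant part.\<close>

lemma HIST_of_parent:
  fixes rk :: "'a \<Rightarrow> nat"
  assumes conn: "connected_graph V E" and r: "r \<in> C"
    and par: "\<And>v. v \<in> C \<Longrightarrow> v \<noteq> r \<Longrightarrow> par v \<in> C \<and> rk (par v) < rk v"
    and deg: "\<And>v. v \<in> C \<Longrightarrow>
      degree ((\<lambda>v. {v, par v}) ` (C - {r})) v + degree pendant_edges v \<noteq> 2"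
  shows "\<exists>T. HIST V E T"
proof -
  let ?S = "(\<lambda>v. {v, par v}) ` (C - {r})"
  have st: "spanning_tree V E (?S \<union> pendant_edges)"
    using spanning_tree_of_parent[of r par rk] conn r par by blast
  then have sub: "?S \<union> pendant_edges \<subseteq> E" by (simp add: spanning_tree_def)
  have "degree (?S \<union> pendant_edges) v \<noteq> 2" if "v \<in> V" for v
  proof (cases "v \<in> C")
    case True
    have "\<forall>e\<in>?S. e \<subseteq> C" using par by auto
    with sub have "degree (?S \<union> pendant_edges) v = degree ?S v + degree pendant_edges v"
      by (intro degree_split) auto
    with deg[OF True] show ?thesis by simp
  next
    case False
    have "degree (?S \<union> pendant_edges) v \<le> degree E v"
      unfolding degree_def using sub finite_E by (intro card_mono) auto
    also have "\<dots> \<le> 1" using False that partition degree_independent by auto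
    finally show ?thesis by simp
  qed
  with st show ?thesis unfolding HIST_def by blast
qed

text \<open>A chain runs from one good vertex through all bad vertices to another good vertex; the
  remaining good vertices hang off the first bad vertex, so that all good vertices are leaves.\<close>

lemma HIST_if_bad_vertex:
  assumes conn: "connected_graph V E"
    and ab: "good E C a" "good E C b" "a \<noteq> b"
    and z: "z \<in> C" "\<not> good E C z"
  shows "\<exists>T. HIST V E T"
proof -
  define B where "B = {v \<in> C. \<not> good E C v}"
  define k where "k = card B"
  have finB: "finite B" using finite_C by (simp add: B_def)
  have "z \<in> B" using z by (simp add: B_def)
  then have k: "1 \<le> k" using finB by (auto simp: k_def Suc_le_eq card_gt_0_iff)
  obtain f where f: "bij_betw f {1..k} B"
    using ex_bij_betw_nat_finite_1[OF finB] by (auto simp: k_def)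
  have aC: "a \<in> C" "b \<in> C" and aB: "a \<notin> B" "b \<notin> B"
    using ab by (auto simp: good_def B_def)
  \<comment> \<open>\<open>h\<close> lists the chain up to its last bad vertex: \<open>a\<close> at
    position 0, the bad vertices at positions 1 to \<open>k\<close>. The far end \<open>b\<close>
    comes after position \<open>k\<close>.\<close>
  define h where "h i = (if i = 0 then a else f i)" for i :: nat
  \<comment> \<open>On the listed chain the rank is the position. Good vertices other than
    \<open>a\<close> get \<open>Suc k\<close>, above every vertex from which they may hang.\<close>
  define rk where
    "rk v = (if v = a then 0 else if v \<in> B then inv_into {1..k} f v else Suc k)" for v
  \<comment> \<open>Hanging \<open>b\<close> from \<open>h k\<close> gives the last bad vertex a
    child too; good vertices other than \<open>a\<close> and \<open>b\<close> hang from
    \<open>h 1\<close>.\<close>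
  define par where
    "par v = (if v \<in> B then h (rk v - 1) else if v = b then h k else h 1)" for v
  let ?S = "(\<lambda>v. {v, par v}) ` (C - {a})"
  have hB: "h i \<in> B" if "1 \<le> i" "i \<le> k" for i
    using that f by (auto simp: h_def bij_betw_def)
  have hC: "h i \<in> C" if "i \<le> k" for i
    using hB[of i] that aC by (cases "i = 0") (auto simp: B_def h_def)
  have rkh: "rk (h i) = i" if "i \<le> k" for i
    using that hB[of i] aB f
    by (auto simp: rk_def h_def bij_betw_def inv_into_f_f)
  have Bh: "1 \<le> rk v \<and> rk v \<le> k \<and> h (rk v) = v" if "v \<in> B" for v
  proof -
    have "v \<in> f ` {1..k}" using that f by (simp add: bij_betw_def)
    then obtain i where "1 \<le> i" "i \<le> k" "v = h i" by (auto simp: h_def)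
    then show ?thesis using rkh by auto
  qed
  have leaf_rk: "rk v = Suc k" if "v \<notin> B" "v \<noteq> a" for v using that by (simp add: rk_def)
  have par_mem: "par v \<in> insert a B" if "v \<in> C" "v \<noteq> a" for v
  proof (cases "v \<in> B")
    case True
    show ?thesis
    proof (cases "rk v = 1")
      case one: True
      show ?thesis using True by (simp add: par_def one) (simp add: h_def)
    next
      case False
      then have "1 \<le> rk v - 1" "rk v - 1 \<le> k" using Bh[OF True] by linarith+
      then show ?thesis using hB True by (simp add: par_def)
    qed
  next
    case False
    then show ?thesis using hB[of k] hB[of 1] k by (auto simp: par_def)
  qed
  have par_rk: "rk (par v) < rk v" if "v \<in> C" "v \<noteq> a" for v
  proof (cases "v \<in> B")
    case True
    then show ?thesis using Bh[OF True] by (auto simp: par_def rkh)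
  next
    case False
    then show ?thesis using that k by (auto simp: par_def rkh leaf_rk)
  qed
  have par: "par v \<in> C \<and> rk (par v) < rk v" if "v \<in> C" "v \<noteq> a" for v
    using par_mem[OF that] par_rk[OF that] aC by (auto simp: B_def)
  have deg: "degree ?S v + degree pendant_edges v \<noteq> 2" if v: "v \<in> C" for v
  proof (cases "v \<in> B")
    case True
    \<comment> \<open>\<open>?w\<close> is the successor of \<open>v\<close> on the chain, hence a
      child of \<open>v\<close>. With the parent edge this gives clique degree at least 2, and the
      single pendant edge raises the total to at least 3.\<close>
    let ?w = "if rk v = k then b else h (Suc (rk v))"
    have rkv: "1 \<le> rk v" "rk v \<le> k" "h (rk v) = v" using Bh[OF True] by auto
    have va: "v \<noteq> a" using True aB by auto
    have wC: "?w \<in> C" and wa: "?w \<noteq> a" and pw: "par ?w = v"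
      using rkv ab(3) aC aB hB[of "Suc (rk v)"] hC[of "Suc (rk v)"]
      by (auto simp: par_def rkh)
    have w_rk: "rk v < rk ?w"
      using par_rk[OF wC wa] pw by simp
    have "{{v, par v}, {?w, v}} \<subseteq> {e \<in> ?S. v \<in> e}"
      using v va wC wa pw by (auto intro: rev_image_eqI)
    \<comment> \<open>The other ends differ: \<open>par v\<close> ranks below \<open>v\<close> and
      \<open>?w\<close> above it.\<close>
    moreover have "{v, par v} \<noteq> {?w, v}"
      using par_rk[OF v va] w_rk by (metis doubleton_eq_iff less_asym less_irrefl)
    moreover have "finite {e \<in> ?S. v \<in> e}" using finite_C by simp
    ultimately have "card {{v, par v}, {?w, v}} = 2"
      "card {{v, par v}, {?w, v}} \<le> degree ?S v"
      unfolding degree_def by (simp_all only: card_2_iff card_mono) blast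
    then have "2 \<le> degree ?S v" by simp
    moreover have "degree pendant_edges v = 1"
      using True by (simp add: B_def good_iff)
    ultimately show ?thesis by simp
  next
    case False
    \<comment> \<open>Good vertices are leaves of the clique tree: \<open>a\<close> has one child,
      and no other good vertex is a parent. Total degree 2 would then require exactly one pendant
      edge.\<close>
    have "\<exists>e. {e \<in> ?S. v \<in> e} = {e}"
    proof (cases "v = a")
      case True
      \<comment> \<open>Good vertices hang from bad ones, so a child of \<open>a\<close> is bad; its
        predecessor having rank 0 makes it \<open>h 1\<close>.\<close>
      have only: "x = h 1" if "x \<in> C" "x \<noteq> a" "par x = a" for x
      proof -
        have xB: "x \<in> B"
          using that hB[of k] hB[of 1] k aB by (auto simp: par_def split: if_splits)
        then have "h (rk x - 1) = a" using that(3) by (simp add: par_def)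
        moreover have "rk (h (rk x - 1)) = rk x - 1" using Bh[OF xB] by (intro rkh) linarith
        moreover have "rk a = 0" by (simp add: rk_def)
        ultimately have "rk x - 1 = 0" by simp
        then show ?thesis using Bh[OF xB] by (metis One_nat_def diff_is_0_eq le_antisym)
      qed
      have h1: "h 1 \<in> C - {a}" "par (h 1) = a"
        using hB[of 1] hC[of 1] k aB by (auto simp: par_def rkh) (simp add: h_def)
      have "{e \<in> ?S. a \<in> e} = {{h 1, a}}"
      proof (intro equalityI subsetI)
        fix e assume "e \<in> {e \<in> ?S. a \<in> e}"
        then obtain x where x: "x \<in> C" "x \<noteq> a" "e = {x, par x}" "par x = a" by auto
        then show "e \<in> {{h 1, a}}" using only[OF x(1,2,4)] by simp
      qed (use h1 in force)
      then show ?thesis using True by blast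
    next
      case va: False
      have "v \<notin> par ` (C - {a})"
        using par_mem False va by auto
      then have "{e \<in> ?S. v \<in> e} = {{v, par v}}"
        using v va by auto
      then show ?thesis by blast
    qed
    then have "degree ?S v = 1" unfolding degree_def by (metis card_1_singleton_iff One_nat_def)
    moreover have "degree pendant_edges v \<noteq> 1"
      using False v good_iff by (auto simp: B_def)
    ultimately show ?thesis by simp
  qed
  show ?thesis
    by (rule HIST_of_parent[OF conn aC(1) par deg])
qed

text \<open>In the star centred at \<open>z\<close> together with the pendant edges,
  \<open>z\<close> keeps its full degree in \<open>E\<close>. Every other clique vertex has one star
  edge and, being good, not exactly one pendant edge.\<close>

lemma HIST_if_all_good:
  assumes conn: "connected_graph V E"
    and all: "\<And>v. v \<in> C \<Longrightarrow> good E C v"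
    and z: "z \<in> C" "degree E z \<noteq> 2"
  shows "\<exists>T. HIST V E T"
proof (rule HIST_of_parent[where r = z and par = "\<lambda>_. z" and rk = "\<lambda>v. if v = z then 0 else 1"])
  let ?S = "(\<lambda>v. {v, z}) ` (C - {z})"
  fix v assume v: "v \<in> C"
  show "degree ?S v + degree pendant_edges v \<noteq> 2"
  proof (cases "v = z")
    case True
    have "{e \<in> ?S. z \<in> e} = ?S" by auto
    moreover have "card ?S = card C - 1"
      using z finite_C by (subst card_image) (auto simp: inj_on_def doubleton_eq_iff)
    ultimately have "degree ?S z = card C - 1" by (simp add: degree_def)
    with True z show ?thesis by (simp add: degree_clique)
  next
    case False
    then have "{e \<in> ?S. v \<in> e} = {{v, z}}" using v by auto
    then have "degree ?S v = 1" by (simp add: degree_def)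
    with all[OF v] show ?thesis by (simp add: good_iff)
  qed
qed (use conn z in auto)

section \<open>The excluded case of a triangle without pendant vertices\<close>

lemma isomorphic_K3:
  assumes conn: "connected_graph V E" and c: "card C = 3"
    and deg: "\<And>v. v \<in> C \<Longrightarrow> degree E v = 2"
  shows "isomorphic V E {..<3 :: nat} (complete_edges {..<3})"
proof -
  have "C \<noteq> {}" using c by auto
  \<comment> \<open>Two clique neighbours already exhaust degree 2, so no pendant edge is left,
    whereas connectivity would demand one at any vertex of \<open>I\<close>.\<close>
  have "I = {}"
  proof (rule ccontr)
    assume "I \<noteq> {}"
    then obtain x where x: "x \<in> I" by auto
    then obtain w where w: "{x, w} \<in> E"
      using connected_pendant_edge[OF conn subset_refl x \<open>C \<noteq> {}\<close>] by auto
    then have "w \<in> C" using independent x edges partition by blast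
    have "{x, w} \<in> {e \<in> pendant_edges. w \<in> e}"
      using w x partition by (auto simp: pendant_edges_def)
    moreover have "finite {e \<in> pendant_edges. w \<in> e}"
      using finite_E by (simp add: pendant_edges_def)
    ultimately have "0 < degree pendant_edges w"
      unfolding degree_def by (auto simp: card_gt_0_iff)
    with degree_clique[OF \<open>w \<in> C\<close>] deg[OF \<open>w \<in> C\<close>] c show False by simp
  qed
  then have VC: "V = C" using partition by simp
  \<comment> \<open>Since \<open>V\<close> is a clique, any numbering of it is an
    isomorphism.\<close>
  obtain f where f: "bij_betw f V {..<3 :: nat}"
    using ex_bij_betw_finite_nat[OF finite_C] c VC by (auto simp: atLeast0LessThan)
  have "{u, v} \<in> E \<longleftrightarrow> {f u, f v} \<in> complete_edges {..<3}" if "u \<in> V" "v \<in> V" for u v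
  proof -
    have "{u, v} \<in> E \<longleftrightarrow> u \<noteq> v"
      using edges[of "{u, v}"] clique that VC by auto
    also have "\<dots> \<longleftrightarrow> f u \<noteq> f v"
      using f that by (auto simp: bij_betw_def inj_on_def)
    also have "\<dots> \<longleftrightarrow> {f u, f v} \<in> complete_edges {..<3}"
      using f that by (auto simp: bij_betw_def complete_edges_def)
    finally show ?thesis .
  qed
  with f show ?thesis unfolding isomorphic_def by blast
qed

section \<open>Ends of longest paths inside the clique\<close>

lemma connected_clique_edge:
  assumes "connected_graph V T" "T \<subseteq> E" "2 \<le> card C"
  obtains u v where "u \<in> C" "v \<in> C" "{u, v} \<in> T"
proof -
  obtain u v where uv: "u \<in> C" "v \<in> C" "u \<noteq> v"
    using assms(3) by (metis card_le_Suc0_iff_eq finite_C not_less_eq_eq numeral_2_eq_2)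
  have "\<exists>w\<in>C. {u, w} \<in> T"
  proof (rule ccontr)
    assume none: "\<not> ?thesis"
    \<comment> \<open>otherwise \<open>u\<close> and its pendant neighbours form a component of \<open>T\<close>\<close>
    have "(u, v) \<in> {(x, y). {x, y} \<in> T}\<^sup>*"
      using assms(1) uv partition by (auto simp: connected_graph_def)
    then have "v = u \<or> v \<in> I \<and> {v, u} \<in> E"
    proof (induction rule: rtrancl_induct)
      case (step y z)
      then have yz: "{y, z} \<in> T" "{y, z} \<in> E" using assms(2) by auto
      show ?case
      proof (cases "y = u")
        case True
        then have "z \<notin> C" "z \<in> V" using none yz edges by auto
        then show ?thesis using partition yz True by (auto simp: insert_commute)
      next
        case False
        then have "y \<in> I" "{y, u} \<in> E" using step.IH by auto
        then show ?thesis using pendant_unique yz(2) by blast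
      qed
    qed simp
    then show False using uv partition by auto
  qed
  with uv that show thesis by blast
qed

text \<open>Keeping the vertices in \<open>C\<close> gives the paths of the clique part of
  \<open>T\<close> without introducing that part as a tree of its own.\<close>

definition clique_path :: "'a set set \<Rightarrow> 'a list \<Rightarrow> bool" where
  "clique_path T p \<longleftrightarrow>
     distinct p \<and> set p \<subseteq> C \<and> (\<forall>i. Suc i < length p \<longrightarrow> {p ! i, p ! Suc i} \<in> T)"

text \<open>Transfers what is shown for the head of a longest path to its other end.\<close>

lemma clique_path_rev: "clique_path T p \<Longrightarrow> clique_path T (rev p)"
proof -
  assume p: "clique_path T p"
  have "{rev p ! i, rev p ! Suc i} \<in> T" if i: "Suc i < length (rev p)" for i
  proof -
    let ?j = "length p - Suc (Suc i)"
    have "Suc ?j < length p" "Suc ?j = length p - Suc i" using i by auto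
    then have "{p ! ?j, p ! (length p - Suc i)} \<in> T"
      using p unfolding clique_path_def by metis
    then show ?thesis using i by (simp add: rev_nth insert_commute)
  qed
  then show ?thesis using p by (simp add: clique_path_def)
qed

text \<open>A clique neighbour of the head in \<open>T\<close> outside the path would extend it, and
  one beyond the second vertex would close a cycle. So the head is a leaf of the clique part, and
  exactly one pendant edge would give it degree 2.\<close>

lemma maximal_clique_path_hd_good:
  assumes T: "HIST V E T" and p: "clique_path T p" "2 \<le> length p"
    and mx: "\<And>q. clique_path T q \<Longrightarrow> length q \<le> length p"
  shows "good E C (hd p)"
proof -
  have sub: "T \<subseteq> E" and conn: "connected_graph V T"
    and acyc: "\<And>q. \<not> cycle_of T q" and deg: "\<And>v. v \<in> V \<Longrightarrow> degree T v \<noteq> 2"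
    using T by (auto simp: HIST_def spanning_tree_def tree_def)
  have d: "distinct p" and pC: "set p \<subseteq> C"
    and pT: "\<And>i. Suc i < length p \<Longrightarrow> {p ! i, p ! Suc i} \<in> T"
    using p(1) by (auto simp: clique_path_def)
  let ?u = "hd p"
  have u: "?u = p ! 0" "?u \<in> C" using p(2) pC by (cases p; auto)+
  have nbr: "y = p ! 1" if y: "y \<in> C" "{?u, y} \<in> T" for y
  proof (cases "y \<in> set p")
    case False
    have "clique_path T (y # p)"
      using False y d pC pT u(1)
      by (auto simp: clique_path_def nth_Cons insert_commute split: nat.split)
    then show ?thesis using mx[of "y # p"] by simp
  next
    case True
    then obtain j where j: "j < length p" "y = p ! j" by (metis in_set_conv_nth)
    have "card {?u, y} = 2" using edges y(2) sub by blast
    then have "?u \<noteq> y" by auto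
    then have "j \<noteq> 0" using u(1) j(2) by metis
    show ?thesis
    proof (rule ccontr)
      assume "y \<noteq> p ! 1"
      with \<open>j \<noteq> 0\<close> j have j2: "2 \<le> j" by (cases "j = 1") auto
      \<comment> \<open>The initial segment up to position \<open>j\<close> is closed by the edge
        from \<open>y\<close> back to the head; \<open>2 \<le> j\<close> gives it the three vertices
        a cycle needs.\<close>
      have "cycle_of T (take (Suc j) p)"
        unfolding cycle_of_def
      proof (intro conjI allI impI)
        fix i assume "i < length (take (Suc j) p)"
        then have i: "i \<le> j" using j by simp
        show "{take (Suc j) p ! i, take (Suc j) p ! (Suc i mod length (take (Suc j) p))} \<in> T"
        proof (cases "i = j")
          case True
          then show ?thesis using j y(2) u(1) by (simp add: insert_commute)
        next
          case False
          then show ?thesis using i j pT[of i] by simp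
        qed
      qed (use j j2 d in auto)
      with acyc show False by blast
    qed
  qed
  let ?S = "{e \<in> T. e \<subseteq> C}"
  have "{e \<in> ?S. ?u \<in> e} = {{?u, p ! 1}}"
  proof (intro equalityI subsetI)
    fix e assume e: "e \<in> {e \<in> ?S. ?u \<in> e}"
    then have "card e = 2" using edges sub by auto
    with e obtain y where "e = {?u, y}" by (auto simp: card_2_iff)
    with e nbr[of y] show "e \<in> {{?u, p ! 1}}" by auto
  qed (use pT[of 0] p(2) pC u in auto)
  then have "degree ?S ?u = 1" by (simp add: degree_def)
  \<comment> \<open>Connectivity puts every pendant edge into \<open>T\<close>, so the degree of the
    head splits into its clique and pendant parts.\<close>
  moreover have "?S \<union> pendant_edges = T"
    using pendant_edges_subset[OF conn sub] sub by (auto simp: pendant_edges_def)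
  moreover have "degree (?S \<union> pendant_edges) ?u = degree ?S ?u + degree pendant_edges ?u"
    by (rule degree_split) (use sub in auto)
  ultimately have "degree pendant_edges ?u \<noteq> 1"
    using deg[of ?u] u(2) partition by auto
  with u(2) show ?thesis by (simp add: good_iff)
qed

lemma two_good_if_HIST:
  assumes T: "HIST V E T" and c: "2 \<le> card C"
  obtains a b where "good E C a" "good E C b" "a \<noteq> b"
proof -
  have sub: "T \<subseteq> E" and conn: "connected_graph V T"
    using T by (auto simp: HIST_def spanning_tree_def tree_def)
  \<comment> \<open>An edge inside the clique is a path on two vertices, so a longest path has two
    different ends.\<close>
  obtain u v where uv: "u \<in> C" "v \<in> C" "{u, v} \<in> T"
    using connected_clique_edge[OF conn sub c] .
  then have "u \<noteq> v" using edges[of "{u, v}"] sub by auto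
  with uv have path: "clique_path T [u, v]" by (simp add: clique_path_def)
  \<comment> \<open>Distinct vertices of \<open>C\<close> number at most \<open>card C\<close>; the
    successor makes the bound strict, as the existence of a greatest length requires.\<close>
  have "length q < Suc (card C)" if "clique_path T q" for q
    using that finite_C by (metis card_mono clique_path_def distinct_card less_Suc_eq_le)
  then have "\<exists>p. clique_path T p \<and> (\<forall>q. clique_path T q \<longrightarrow> length q \<le> length p)"
    by (intro ex_has_greatest_nat[where k = "[u, v]" and b = "Suc (card C)"]) (use path in simp_all)
  then obtain p where p: "clique_path T p" "\<And>q. clique_path T q \<Longrightarrow> length q \<le> length p"
    by blast
  have len: "2 \<le> length p" using p(2)[OF path] by simp
  have "good E C (hd p)"
    using maximal_clique_path_hd_good[OF T p(1) len p(2)] .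
  moreover have "good E C (hd (rev p))"
    using maximal_clique_path_hd_good[OF T clique_path_rev[OF p(1)]] p(2) len by simp
  moreover have "hd p \<noteq> hd (rev p)"
  proof -
    have "hd p = p ! 0" "hd (rev p) = p ! (length p - 1)"
      using len by (cases "p = []"; simp add: hd_conv_nth hd_rev last_conv_nth)+
    moreover have "distinct p" using p(1) by (simp add: clique_path_def)
    ultimately show ?thesis using len nth_eq_iff_index_eq[of p 0 "length p - 1"] by (cases "length p") auto
  qed
  ultimately show thesis by (rule that)
qed

end

theorem theorem2:
  fixes V C I :: "'a set" and E :: "'a set set"
  assumes "block_split_graph V E C I"
    and "connected_graph V E"
    and "\<not> tree V E"
    and "\<not> isomorphic V E {..<3 :: nat} (complete_edges {..<3})"
  shows "(\<exists>T. HIST V E T) \<longleftrightarrow> 2 \<le> card {u. good E C u}"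
proof -
  interpret block_split_graph V E C I by (fact assms(1))
  have c: "3 \<le> card C" using card_clique_ge_3 assms(2,3) .
  have fin: "finite {u. good E C u}"
    by (rule finite_subset[OF _ finite_C]) (auto simp: good_def)
  have two: "2 \<le> card {u. good E C u} \<longleftrightarrow> (\<exists>a b. good E C a \<and> good E C b \<and> a \<noteq> b)"
    using card_le_Suc0_iff_eq[OF fin] by (auto simp: not_less_eq_eq[symmetric] numeral_2_eq_2)
  show ?thesis
  proof
    assume "\<exists>T. HIST V E T"
    then show "2 \<le> card {u. good E C u}"
      unfolding two using two_good_if_HIST c by (metis Suc_leD eval_nat_numeral(3))
  next
    assume "2 \<le> card {u. good E C u}"
    then obtain a b where ab: "good E C a" "good E C b" "a \<noteq> b"
      unfolding two by blast
    show "\<exists>T. HIST V E T"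
    proof (cases "\<forall>v\<in>C. good E C v")
      case False
      then show ?thesis using HIST_if_bad_vertex[OF assms(2) ab] by blast
    next
      case all: True
      \<comment> \<open>A centre for the star: if \<open>card C = 3\<close>, all degrees being 2
        would make the graph \<open>K_3\<close>; if \<open>card C\<close> is larger, every clique
        vertex has degree at least 3, so \<open>a\<close> serves.\<close>
      have "\<exists>z\<in>C. degree E z \<noteq> 2"
      proof (cases "card C = 3")
        case True
        then show ?thesis using isomorphic_K3[OF assms(2)] assms(4) by blast
      next
        case False
        moreover have "a \<in> C" using ab(1) by (simp add: good_def)
        ultimately show ?thesis using c by (intro bexI[of _ a]) (auto simp: degree_clique)
      qed
      then show ?thesis using HIST_if_all_good[OF assms(2)] all by blast
    qed
  qed
qed

end
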